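(* Let $p$ be a prime, let $r$ be a positive integer with $3\le r<p$, and let $G=C_p^r$. Then $$\mathsf{s}_{\le \mathsf D(G)-2}(G)=\mathsf D(G)+1.$$
   Context: $C_m$ denotes the cyclic group of order $m$, written additively, and $C_m^r$ is the direct sum of $r$ copies of $C_m$. For a finite abelian group $G$ (written additively), a sequence over $G$ is a finite unordered list of elements of $G$ with repetition allowed (a finite multiset); its length is its number of terms counted with multiplicity, and it is zero-sum if the sum of its terms (with multiplicity) is $0$. A subsequence is a sub-multiset. The Davenport constant $\mathsf D(G)$ is the smallest integer $\ell$ such that every sequence over $G$ of length $\ell$ has a nonempty zero-sum subsequence. For an integer $t$ with $\exp(G)\le t\le \mathsf D(G)$, where $\exp(G)$ is the exponent of $G$, $\mathsf{s}_{\le t}(G)$ denotes the smallest integer $\ell$ such that every sequence over $G$ of length $\ell$ has a zero-sum subsequence $T$ of length $1\le |T|\le t$. *)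

theory Defs
  imports "HOL-Algebra.Product_Groups" "HOL-Algebra.FiniteProduct" "HOL-Library.Multiset"
    "HOL-Computational_Algebra.Primes"
begin

text \<open>HOL-Algebra writes groups multiplicatively. The library's
  \<^const>\<open>integer_mod_group\<close> has addition modulo \<open>m\<close> as its operation
  and \<open>0\<close> as its neutral element, so below \<open>\<one>\<^bsub>G\<^esub>\<close> is the zero of \<open>G\<close>, a
  \<^const>\<open>finprod\<close> is a sum, and \<open>g [^]\<^bsub>G\<^esub> n\<close> is the multiple \<open>n g\<close>.\<close>

definition cyclic_power :: "nat \<Rightarrow> nat \<Rightarrow> (nat \<Rightarrow> int) monoid" where
  "cyclic_power m r = product_group {..<r} (\<lambda>_. integer_mod_group m)"

definition sequence_over :: "('a, 'b) monoid_scheme \<Rightarrow> 'a multiset \<Rightarrow> bool" where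
  "sequence_over G S \<longleftrightarrow> set_mset S \<subseteq> carrier G"

text \<open>The sum of the terms of a sequence, each term counted with its multiplicity.\<close>

definition seq_sum :: "('a, 'b) monoid_scheme \<Rightarrow> 'a multiset \<Rightarrow> 'a" where
  "seq_sum G S = finprod G (\<lambda>g. g [^]\<^bsub>G\<^esub> count S g) (set_mset S)"

definition zero_sum :: "('a, 'b) monoid_scheme \<Rightarrow> 'a multiset \<Rightarrow> bool" where
  "zero_sum G S \<longleftrightarrow> seq_sum G S = \<one>\<^bsub>G\<^esub>"

definition davenport :: "('a, 'b) monoid_scheme \<Rightarrow> nat" where
  "davenport G = (LEAST l. \<forall>S. sequence_over G S \<and> size S = l \<longrightarrow>
     (\<exists>T. T \<subseteq># S \<and> T \<noteq> {#} \<and> zero_sum G T))"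

text \<open>The constant \<open>s\<^sub>\<le>\<^sub>t(G)\<close>. It is meant for \<open>exp(G) \<le> t \<le> D(G)\<close>; for smaller \<open>t\<close>
  no such length need exist, and \<^const>\<open>Least\<close> is then unspecified.\<close>

definition s_le :: "nat \<Rightarrow> ('a, 'b) monoid_scheme \<Rightarrow> nat" where
  "s_le t G = (LEAST l. \<forall>S. sequence_over G S \<and> size S = l \<longrightarrow>
     (\<exists>T. T \<subseteq># S \<and> 1 \<le> size T \<and> size T \<le> t \<and> zero_sum G T))"

end

theory Submission
  imports Defs "HOL-Number_Theory.Residues"
begin

text \<open>By the Chevalley--Warning argument, over every index set of more than \<open>r(p - 1)\<close> terms the
  zero-sum index sets, counted with sign \<open>(-1)\<^sup>|\<^sup>T\<^sup>|\<close>, add up to \<open>0\<close> modulo \<open>p\<close>. Let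
  \<open>D = r(p - 1) + 1\<close> and let a sequence of length \<open>D + 1\<close> with sum \<open>\<sigma>\<close> have no nonempty zero-sum
  subsequence of length at most \<open>D - 2\<close>. Then all nonempty ones have length \<open>D - 1\<close> or \<open>D\<close>:
  they omit a pair of terms with sum \<open>\<sigma>\<close>, or one term equal to \<open>\<sigma>\<close>. Applying the
  congruence to the whole sequence and to the sequence without one term shows that \<open>\<sigma>\<close> has
  multiplicity \<open>r\<close>, and that for every term \<open>g \<noteq> \<sigma>\<close> the elements \<open>g\<close> and \<open>\<sigma> - g\<close> are distinct
  and have multiplicity \<open>p - 1\<close>. Hence \<open>p - 1\<close> divides \<open>r(p - 1) + 2 - r\<close>, so it divides
  \<open>r - 2\<close>, contradicting \<open>0 < r - 2 < p - 1\<close>.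
  For the lower bound take each unit vector \<open>p - 1\<close> times together with the all-ones vector.\<close>

section \<open>Signed sums over subsets as a substitute for polynomial degree\<close>

text \<open>Stands in for ``\<open>f\<close> is a polynomial of degree at most \<open>d\<close> in the indicator variables of \<open>T\<close>''.
  The sets \<open>J\<close> play the role of monomials; they make the property stable under
  multiplication by linear forms.\<close>

definition annihilated :: "'i set \<Rightarrow> nat \<Rightarrow> ('i set \<Rightarrow> int) \<Rightarrow> bool" where
  "annihilated I d f \<longleftrightarrow> (\<forall>J\<subseteq>I. card J + d < card I \<longrightarrow>
     (\<Sum>T | J \<subseteq> T \<and> T \<subseteq> I. (-1) ^ card T * f T) = 0)"

text \<open>Toggling a fixed element of \<open>I - J\<close> pairs the sets \<open>T\<close> with
  opposite signs.\<close>

lemma alternating_interval_sum: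
  assumes "finite I" "J \<subset> I"
  shows "(\<Sum>T | J \<subseteq> T \<and> T \<subseteq> I. (-1) ^ card T) = (0::int)"
proof -
  obtain x where x: "x \<in> I" "x \<notin> J" using assms by blast
  let ?A = "{T. J \<subseteq> T \<and> T \<subseteq> I - {x}}"
  have fin: "finite ?A" using assms by (auto intro: finite_subset[of _ "Pow I"])
  have split: "{T. J \<subseteq> T \<and> T \<subseteq> I} = ?A \<union> insert x ` ?A"
  proof (intro equalityI subsetI)
    fix T assume T: "T \<in> {T. J \<subseteq> T \<and> T \<subseteq> I}"
    show "T \<in> ?A \<union> insert x ` ?A"
    proof (cases "x \<in> T")
      case True
      then have "T = insert x (T - {x})" by auto
      moreover have "T - {x} \<in> ?A" using T x by auto
      ultimately show ?thesis by blast
    qed (use T in auto)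
  qed (use x in auto)
  have inj: "inj_on (insert x) ?A" by (rule inj_onI) blast
  have card: "card (insert x T) = Suc (card T)" if "T \<in> ?A" for T
    using that finite_subset[OF _ assms(1)] by (subst card_insert_disjoint) auto
  have "(\<Sum>T | J \<subseteq> T \<and> T \<subseteq> I. (-1) ^ card T :: int)
      = (\<Sum>T\<in>?A. (-1) ^ card T) + (\<Sum>T\<in>insert x ` ?A. (-1) ^ card T)"
    unfolding split using fin by (intro sum.union_disjoint) auto
  also have "(\<Sum>T\<in>insert x ` ?A. (-1) ^ card T :: int) = (\<Sum>T\<in>?A. - ((-1) ^ card T))"
    by (subst sum.reindex[OF inj]) (auto intro!: sum.cong simp: card)
  finally show ?thesis by (simp add: sum_negf)
qed

lemma annihilated_one:
  assumes "finite I"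
  shows "annihilated I 0 (\<lambda>_. 1)"
  unfolding annihilated_def
proof (intro allI impI)
  fix J assume "J \<subseteq> I" "card J + 0 < card I"
  then have "J \<subset> I" by auto
  from alternating_interval_sum[OF assms this]
  show "(\<Sum>T | J \<subseteq> T \<and> T \<subseteq> I. (-1) ^ card T * 1 :: int) = 0" by simp
qed

lemma annihilated_mono: "annihilated I d f \<Longrightarrow> d \<le> e \<Longrightarrow> annihilated I e f"
  by (auto simp: annihilated_def)

lemma annihilated_diff:
  "annihilated I d f \<Longrightarrow> annihilated I d g \<Longrightarrow> annihilated I d (\<lambda>T. f T - g T)"
  by (simp add: annihilated_def right_diff_distrib sum_subtractf)

text \<open>Write \<open>sum b T\<close> as the sum of \<open>b i\<close> over the \<open>i\<close>
  in \<open>I\<close> that lie in \<open>T\<close>. Requiring \<open>i\<close> to lie in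
  \<open>T\<close> replaces \<open>J\<close> by \<open>insert i J\<close>, which has at most one
  element more; the extra degree pays for it.\<close>

lemma annihilated_mult_linear:
  fixes b :: "'i \<Rightarrow> int"
  assumes "finite I" "annihilated I d f"
  shows "annihilated I (Suc d) (\<lambda>T. sum b T * f T)"
  unfolding annihilated_def
proof (intro allI impI)
  fix J assume J: "J \<subseteq> I" "card J + Suc d < card I"
  have finJ: "finite J" using J assms finite_subset by blast
  have fin: "finite {T. J \<subseteq> T \<and> T \<subseteq> I}" using assms by (auto intro: finite_subset[of _ "Pow I"])
  have lin: "sum b T = (\<Sum>i\<in>I. if i \<in> T then b i else 0)" if "T \<subseteq> I" for T
    using that assms by (simp add: sum.inter_restrict[symmetric] Int_absorb1)
  have "(\<Sum>T | J \<subseteq> T \<and> T \<subseteq> I. (-1) ^ card T * (sum b T * f T))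
      = (\<Sum>T | J \<subseteq> T \<and> T \<subseteq> I. \<Sum>i\<in>I. if i \<in> T then b i * ((-1) ^ card T * f T) else 0)"
    by (rule sum.cong) (auto simp: lin sum_distrib_left sum_distrib_right intro!: sum.cong)
  also have "\<dots> = (\<Sum>i\<in>I. \<Sum>T | J \<subseteq> T \<and> T \<subseteq> I. if i \<in> T then b i * ((-1) ^ card T * f T) else 0)"
    by (rule sum.swap)
  also have "\<dots> = (\<Sum>i\<in>I. b i * (\<Sum>T | insert i J \<subseteq> T \<and> T \<subseteq> I. (-1) ^ card T * f T))"
    unfolding sum_distrib_left
  proof (rule sum.cong[OF refl])
    fix i
    have "{T. insert i J \<subseteq> T \<and> T \<subseteq> I} = {T \<in> {T. J \<subseteq> T \<and> T \<subseteq> I}. i \<in> T}" by auto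
    then show "(\<Sum>T | J \<subseteq> T \<and> T \<subseteq> I. if i \<in> T then b i * ((-1) ^ card T * f T) else 0)
        = (\<Sum>T | insert i J \<subseteq> T \<and> T \<subseteq> I. b i * ((-1) ^ card T * f T))"
      by (simp only: sum.inter_filter[OF fin])
  qed
  also have "\<dots> = 0"
  proof (rule sum.neutral, rule ballI)
    fix i assume i: "i \<in> I"
    have "card (insert i J) + d < card I"
      using J finJ by (simp add: card_insert_if)
    moreover have "insert i J \<subseteq> I" using J i by simp
    ultimately have "(\<Sum>T | insert i J \<subseteq> T \<and> T \<subseteq> I. (-1) ^ card T * f T) = 0"
      using assms(2) unfolding annihilated_def by blast
    then show "b i * (\<Sum>T | insert i J \<subseteq> T \<and> T \<subseteq> I. (-1) ^ card T * f T) = 0"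
      by simp
  qed
  finally show "(\<Sum>T | J \<subseteq> T \<and> T \<subseteq> I. (-1) ^ card T * (sum b T * f T)) = 0" .
qed

lemma annihilated_mult_linear_power:
  fixes b :: "'i \<Rightarrow> int"
  assumes "finite I" "annihilated I d f"
  shows "annihilated I (d + n) (\<lambda>T. sum b T ^ n * f T)"
proof (induction n)
  case (Suc n)
  from annihilated_mult_linear[OF assms(1) Suc.IH, of b] show ?case by (simp add: mult.assoc)
qed (use assms in simp)

text \<open>Each of the \<open>r\<close> factors is a constant minus the \<open>n\<close>-th power
  of a linear form and so raises the degree by \<open>n\<close>.\<close>

lemma annihilated_prod:
  fixes a :: "'i \<Rightarrow> nat \<Rightarrow> int"
  assumes "finite I"
  shows "annihilated I (r * n) (\<lambda>T. \<Prod>j<r. 1 - (\<Sum>i\<in>T. a i j) ^ n)"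
proof (induction r)
  case (Suc r)
  have "annihilated I (r * n + n) (\<lambda>T. (\<Prod>j<r. 1 - (\<Sum>i\<in>T. a i j) ^ n)
      - (\<Sum>i\<in>T. a i r) ^ n * (\<Prod>j<r. 1 - (\<Sum>i\<in>T. a i j) ^ n))"
    by (rule annihilated_diff[OF annihilated_mono[OF Suc.IH le_add1]
          annihilated_mult_linear_power[OF assms Suc.IH]])
  then show ?case
    by (simp only: prod.lessThan_Suc mult_Suc add.commute[of n] right_diff_distrib mult_1_right
        mult.commute[of "_ ^ n"])
next
  case 0
  from annihilated_one[OF assms] show ?case by (simp only: lessThan_0 prod.empty mult_0)
qed

section \<open>The Chevalley-Warning congruence\<close>

text \<open>Vanishing in the group, expressed for integer representatives: the combinatorial
  argument can then add plain integers without reducing them.\<close>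

definition null_vec :: "nat \<Rightarrow> nat \<Rightarrow> (nat \<Rightarrow> int) \<Rightarrow> bool" where
  "null_vec p r v \<longleftrightarrow> (\<forall>j<r. int p dvd v j)"

lemma fermat_indicator:
  assumes "prime p"
  shows "[1 - x ^ (p - 1) = of_bool (int p dvd x)] (mod int p)"
proof (cases "int p dvd x")
  case True
  \<comment> \<open>With exponent \<open>0\<close> the power would be \<open>1\<close> even at
    multiples of \<open>p\<close>.\<close>
  have "p - 1 \<noteq> 0" using prime_gt_1_nat[OF assms] by simp
  then have "int p dvd x ^ (p - 1)" using True by (meson dvd_power dvd_trans gr0I)
  then show ?thesis using True by (simp add: cong_iff_dvd_diff)
next
  case False
  have p0: "int p > 0" using prime_gt_0_nat[OF assms] by simp
  \<comment> \<open>\<open>fermat_theorem\<close> is applied to a natural number, hence the passage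
    to the residue of \<open>x\<close>.\<close>
  define n where "n = nat (x mod int p)"
  have n: "int n = x mod int p" using p0 by (simp add: n_def)
  have "int p dvd int n \<longleftrightarrow> int p dvd x" unfolding n by (simp add: dvd_mod_iff)
  then have "\<not> p dvd n" using False by simp
  then have "[n ^ (p - 1) = 1] (mod p)" using fermat_theorem[OF assms] by blast
  then have "[int (n ^ (p - 1)) = int 1] (mod int p)" unfolding cong_int_iff .
  then have "[int n ^ (p - 1) = 1] (mod int p)" by simp
  moreover have "[int n ^ (p - 1) = x ^ (p - 1)] (mod int p)"
    unfolding n by (intro cong_pow) (simp add: cong_def)
  ultimately have "[x ^ (p - 1) = 1] (mod int p)" using cong_sym cong_trans by blast
  then show ?thesis using False by (simp add: cong_iff_dvd_diff) (simp add: dvd_diff_commute)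
qed

text \<open>Modulo \<open>p\<close> the product of the factors \<open>1 - x ^ (p - 1)\<close> is the
  indicator of null index sets. Its degree \<open>r * (p - 1)\<close> is below
  \<open>card I\<close>, so \<open>annihilated\<close> with \<open>J = {}\<close> makes the signed
  sum vanish.\<close>

lemma alternating_null_count:
  fixes a :: "'i \<Rightarrow> nat \<Rightarrow> int"
  assumes "prime p" "finite I" "r * (p - 1) < card I"
  shows "int p dvd (\<Sum>T | T \<subseteq> I \<and> null_vec p r (\<lambda>j. \<Sum>i\<in>T. a i j). (-1) ^ card T)"
proof -
  let ?f = "\<lambda>T. \<Prod>j<r. 1 - (\<Sum>i\<in>T. a i j) ^ (p - 1)"
  let ?N = "\<lambda>T. null_vec p r (\<lambda>j. \<Sum>i\<in>T. a i j)"
  have "[?f T = (\<Prod>j<r. of_bool (int p dvd (\<Sum>i\<in>T. a i j)))] (mod int p)" for T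
    by (intro cong_prod fermat_indicator assms)
  moreover have "(\<Prod>j<r. of_bool (int p dvd (\<Sum>i\<in>T. a i j))) = (of_bool (?N T) :: int)" for T
    unfolding null_vec_def by (auto simp: of_bool_def intro!: prod.neutral)
  ultimately have f: "[?f T = of_bool (?N T)] (mod int p)" for T by simp
  have "(\<Sum>T | T \<subseteq> I. (-1) ^ card T * ?f T) = 0"
    using annihilated_prod[OF assms(2), of r "p - 1" a] assms(3)
    unfolding annihilated_def by (elim allE[of _ "{}"]) simp
  moreover have "[(\<Sum>T | T \<subseteq> I. (-1) ^ card T * ?f T)
      = (\<Sum>T | T \<subseteq> I. (-1) ^ card T * of_bool (?N T))] (mod int p)"
    by (intro cong_sum cong_mult cong_refl f)
  moreover have "(\<Sum>T | T \<subseteq> I. (-1) ^ card T * of_bool (?N T))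
      = (\<Sum>T | T \<subseteq> I \<and> ?N T. (-1) ^ card T :: int)"
    using assms(2) by (intro sum.mono_neutral_cong_right) auto
  ultimately have "[0 = (\<Sum>T | T \<subseteq> I \<and> ?N T. (-1) ^ card T :: int)] (mod int p)"
    by (simp only:)
  then show ?thesis by (simp only: cong_iff_dvd_diff diff_0 dvd_minus_iff)
qed

text \<open>If only the empty set were null, the signed count would be \<open>1\<close>, which
  \<open>p\<close> does not divide.\<close>

lemma exists_null_subset:
  fixes a :: "'i \<Rightarrow> nat \<Rightarrow> int"
  assumes "prime p" "finite I" "r * (p - 1) < card I"
  obtains T where "T \<subseteq> I" "T \<noteq> {}" "null_vec p r (\<lambda>j. \<Sum>i\<in>T. a i j)"
proof (rule ccontr)
  assume "\<not> thesis"
  then have "{T. T \<subseteq> I \<and> null_vec p r (\<lambda>j. \<Sum>i\<in>T. a i j)} = {{}}"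
    using that by (auto simp: null_vec_def)
  with alternating_null_count[OF assms, of a] have "int p dvd (\<Sum>T\<in>{{}::'i set}. (-1) ^ card T)"
    by (simp only:)
  then show False using prime_gt_1_nat[OF assms(1)] by simp
qed

section \<open>Null index sets of bounded size\<close>

lemma card_corank_one_subsets:
  assumes "finite J" "card J = Suc k"
  shows "card {T. T \<subseteq> J \<and> card T = k \<and> P T} = card {i \<in> J. P (J - {i})}"
proof -
  have "bij_betw (\<lambda>i. J - {i}) {i \<in> J. P (J - {i})} {T. T \<subseteq> J \<and> card T = k \<and> P T}"
  proof (rule bij_betwI')
    fix T assume T: "T \<in> {T. T \<subseteq> J \<and> card T = k \<and> P T}"
    then have "card (J - T) = 1"
      using assms finite_subset[of T J] by (auto simp: card_Diff_subset)
    then obtain i where "J - T = {i}" by (auto simp: card_1_singleton_iff)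
    then have "i \<in> J" "T = J - {i}" using T by auto
    then show "\<exists>i\<in>{i \<in> J. P (J - {i})}. T = J - {i}" using T by auto
  qed (use assms in auto)
  then show ?thesis by (simp add: bij_betw_same_card)
qed

text \<open>Double counting: each \<open>T\<close> of size \<open>k\<close> is avoided by
  \<open>card I - k\<close> indices.\<close>

lemma sum_card_subsets_avoiding:
  assumes "finite I"
  shows "(\<Sum>i\<in>I. card {T. T \<subseteq> I - {i} \<and> card T = k \<and> P T})
       = (card I - k) * card {T. T \<subseteq> I \<and> card T = k \<and> P T}"
proof -
  let ?Z = "{T. T \<subseteq> I \<and> card T = k \<and> P T}"
  have fin: "finite ?Z" using assms by (auto intro: finite_subset[of _ "Pow I"])
  have "(\<Sum>i\<in>I. card {T \<in> ?Z. i \<notin> T}) = (card I - k) * card ?Z"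
  proof (rule sum_multicount[OF assms fin], rule ballI)
    fix T assume T: "T \<in> ?Z"
    have "{i \<in> I. i \<notin> T} = I - T" by auto
    then show "card {i \<in> I. i \<notin> T} = card I - k"
      using T assms finite_subset[of T I] by (auto simp: card_Diff_subset)
  qed
  moreover have "{T \<in> ?Z. i \<notin> T} = {T. T \<subseteq> I - {i} \<and> card T = k \<and> P T}" for i by auto
  ultimately show ?thesis by simp
qed

lemma null_vec_diff: "null_vec p r u \<Longrightarrow> null_vec p r v \<Longrightarrow> null_vec p r (\<lambda>j. u j - v j)"
  by (simp add: null_vec_def)

text \<open>The upper bound in terms of indices: with \<open>D = r * (p - 1) + 1\<close>, the index
  set has \<open>D + 1\<close> elements and the bound on \<open>card T\<close> says at most
  \<open>D - 2\<close>.\<close>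

lemma short_null_subset:
  fixes a :: "'i \<Rightarrow> nat \<Rightarrow> int"
  assumes p: "prime p" and r: "3 \<le> r" "r < p"
    and I: "finite I" "card I = r * (p - 1) + 2"
  obtains T where "T \<subseteq> I" "T \<noteq> {}" "card T < r * (p - 1)" "null_vec p r (\<lambda>j. \<Sum>i\<in>T. a i j)"
proof (rule ccontr)
  assume "\<not> thesis"
  then have no: "\<not> null_vec p r (\<lambda>j. \<Sum>i\<in>T. a i j)"
    if "T \<subseteq> I" "T \<noteq> {}" "card T < r * (p - 1)" for T
    using that \<open>\<And>T. T \<subseteq> I \<Longrightarrow> T \<noteq> {} \<Longrightarrow> card T < r * (p - 1) \<Longrightarrow> null_vec p r (\<lambda>j. \<Sum>i\<in>T. a i j) \<Longrightarrow> thesis\<close>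
    by blast
  define m where "m = r * (p - 1)"
  define Z where "Z T \<longleftrightarrow> null_vec p r (\<lambda>j. \<Sum>i\<in>T. a i j)" for T
  define \<sigma> where "\<sigma> j = (\<Sum>i\<in>I. a i j)" for j
  have cardI: "card I = m + 2" using I by (simp add: m_def)
  have fin: "finite T" if "T \<subseteq> I" for T using that I finite_subset by blast
  have long: "m \<le> card T" if "T \<subseteq> I" "T \<noteq> {}" "Z T" for T
    using no[OF that(1,2)] that(3) unfolding Z_def m_def by linarith
  have "3 * (p - 1) \<le> m" unfolding m_def using r by (intro mult_right_mono) simp_all
  then have m: "p < m" "2 < m" using r by linarith+
  \<comment> \<open>The parity of \<open>m\<close> fixes the signs: null sets of size
    \<open>m\<close> count \<open>+1\<close>, those of size \<open>Suc m\<close> count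
    \<open>-1\<close>.\<close>
  have "odd p" using p r by (intro prime_odd_nat) simp_all
  then have even: "even m" unfolding m_def by simp
  have compl: "(\<Sum>i\<in>I - T. a i j) = \<sigma> j - (\<Sum>i\<in>T. a i j)" if "T \<subseteq> I" for T j
    unfolding \<sigma>_def using I(1) that by (rule sum_diff)
  \<comment> \<open>Otherwise a nonempty null set avoiding one index and its complement would both
    be null of size at least \<open>m\<close>, giving \<open>2 * m \<le> m + 2\<close>.\<close>
  have notI: "\<not> Z I"
  proof
    assume "Z I"
    obtain i where i: "i \<in> I" using cardI by fastforce
    have "m < card (I - {i})" using i cardI I(1) by simp
    with exists_null_subset[OF p, of "I - {i}" r a] I(1)
    obtain T where T: "T \<subseteq> I - {i}" "T \<noteq> {}" "Z T" unfolding m_def Z_def by blast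
    have "Z (I - T)"
      using null_vec_diff[OF \<open>Z I\<close>[unfolded Z_def] T(3)[unfolded Z_def]] compl[of T] T(1)
      unfolding Z_def \<sigma>_def by (simp add: subset_Diff_insert)
    then have "m \<le> card (I - T)" using T(1) i by (intro long) auto
    moreover have "m \<le> card T" using T by (intro long) auto
    moreover have "card (I - T) + card T = m + 2"
      using card_Diff_subset[of T I] card_mono[of I T] fin[of T] T(1) I(1) cardI by fastforce
    ultimately show False using m by linarith
  qed

  define z where "z k J = card {T. T \<subseteq> J \<and> card T = k \<and> Z T}" for k J
  \<comment> \<open>The \<open>1\<close> comes from the empty set. By \<open>long\<close> and
    \<open>notI\<close> every other null subset has size \<open>m\<close> or
    \<open>Suc m\<close>.\<close>
  have rel: "[1 + int (z m J) = int (z (Suc m) J)] (mod int p)" if J: "J \<subseteq> I" "m < card J" for J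
  proof -
    let ?A = "{T. T \<subseteq> J \<and> card T = m \<and> Z T}" and ?B = "{T. T \<subseteq> J \<and> card T = Suc m \<and> Z T}"
    have finAB: "finite ?A" "finite ?B" using fin[OF J(1)] by auto
    have cases: "T = {} \<or> card T = m \<or> card T = Suc m" if T: "T \<subseteq> J" "Z T" for T
    proof (rule ccontr)
      assume neg: "\<not> ?thesis"
      have TI: "T \<subseteq> I" using T J by blast
      have "m \<le> card T" using neg T TI by (intro long) auto
      moreover have "card T \<le> m + 2" using card_mono[OF I(1) TI] cardI by simp
      ultimately have "card T = card I" using neg cardI by linarith
      then have "T = I" using card_subset_eq[OF I(1) TI] by simp
      then show False using notI T by simp
    qed
    have "Z {}" by (simp add: Z_def null_vec_def)
    then have "{T. T \<subseteq> J \<and> Z T} = insert {} (?A \<union> ?B)" using cases by blast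
    then have "(\<Sum>T | T \<subseteq> J \<and> Z T. (-1) ^ card T)
        = (1::int) + ((\<Sum>T\<in>?A. (-1) ^ card T) + (\<Sum>T\<in>?B. (-1) ^ card T))"
      using finAB m by (simp add: sum.insert_if sum.union_disjoint disjoint_iff)
    also have "(\<Sum>T\<in>?A. (-1) ^ card T) = int (z m J)"
      unfolding z_def using even by simp
    also have "(\<Sum>T\<in>?B. (-1) ^ card T) = - int (z (Suc m) J)"
      unfolding z_def using even by simp
    finally have "int p dvd 1 + (int (z m J) + - int (z (Suc m) J))"
      using alternating_null_count[OF p fin[OF J(1)], of r a] J(2) unfolding m_def Z_def by simp
    then show ?thesis by (simp add: cong_iff_dvd_diff algebra_simps)
  qed

  \<comment> \<open>Modulo \<open>p\<close>, \<open>A\<close> collects the indices with term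
    \<open>\<sigma>\<close>, \<open>K i\<close> the other indices whose term adds up with that of
    \<open>i\<close> to \<open>\<sigma>\<close>, and \<open>R i\<close> the indices with the same
    term as \<open>i\<close>.\<close>
  define A where "A = {i \<in> I. Z (I - {i})}"
  define K where "K i = {k \<in> I - {i}. Z (I - {i} - {k})}" for i
  define R where "R i = {k \<in> I. null_vec p r (\<lambda>j. a k j - a i j)}" for i
  have zA: "z (Suc m) I = card A"
    unfolding z_def A_def using card_corank_one_subsets[OF I(1)] cardI by simp
  have cardIi: "card (I - {i}) = Suc m" if "i \<in> I" for i using that I(1) cardI by simp
  have zK: "z m (I - {i}) = card (K i)" if "i \<in> I" for i
    unfolding z_def K_def using card_corank_one_subsets[of "I - {i}"] I(1) cardIi[OF that] by simp
  have ziA: "z (Suc m) (I - {i}) = of_bool (i \<in> A)" if i: "i \<in> I" for i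
  proof -
    have "T = I - {i}" if "T \<subseteq> I - {i}" "card T = Suc m" for T
      using card_subset_eq[OF _ that(1)] I(1) cardIi[OF i] that(2) by simp
    then have "{T. T \<subseteq> I - {i} \<and> card T = Suc m \<and> Z T} = (if Z (I - {i}) then {I - {i}} else {})"
      using cardIi[OF i] by (auto simp only: split: if_split)
    moreover have "i \<in> A \<longleftrightarrow> Z (I - {i})" using i by (simp add: A_def)
    ultimately show ?thesis unfolding z_def by simp
  qed
  \<comment> \<open>In \<open>I - {i}\<close> the only candidate of size \<open>Suc m\<close> is the
    whole set. So \<open>card (K i)\<close> is \<open>0\<close> modulo \<open>p\<close> for
    \<open>i\<close> in \<open>A\<close>, and \<open>-1\<close> otherwise.\<close>
  have relK: "[1 + int (card (K i)) = of_bool (i \<in> A)] (mod int p)" if "i \<in> I" for i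
    using rel[of "I - {i}"] zK[OF that] ziA[OF that] cardIi[OF that] by auto
  \<comment> \<open>Summing \<open>relK\<close> over all \<open>i\<close> counts every \<open>T\<close> as often as it omits an index; comparing with
    \<open>rel\<close> for \<open>I\<close> itself eliminates the number of omitted pairs.\<close>
  have relA: "int p dvd int (card A) - int r"
  proof -
    have "[(\<Sum>i\<in>I. 1 + int (z m (I - {i}))) = (\<Sum>i\<in>I. int (z (Suc m) (I - {i})))] (mod int p)"
      using cardIi by (intro cong_sum rel) auto
    moreover have "(\<Sum>i\<in>I. z m (I - {i})) = 2 * z m I" "(\<Sum>i\<in>I. z (Suc m) (I - {i})) = z (Suc m) I"
      using sum_card_subsets_avoiding[OF I(1), of _ Z] cardI unfolding z_def by simp_all
    then have "(\<Sum>i\<in>I. int (z m (I - {i}))) = 2 * int (z m I)"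
        "(\<Sum>i\<in>I. int (z (Suc m) (I - {i}))) = int (z (Suc m) I)"
      by (simp_all flip: of_nat_sum)
    moreover from this(1) have "(\<Sum>i\<in>I. 1 + int (z m (I - {i}))) = int m + 2 + 2 * int (z m I)"
      by (simp add: sum.distrib cardI)
    ultimately have "int p dvd (int m + 2 + 2 * int (z m I)) - int (card A)"
      by (simp only: cong_iff_dvd_diff zA)
    moreover have "int p dvd (1 + int (z m I)) - int (card A)"
      using rel[of I] cardI by (simp add: cong_iff_dvd_diff zA)
    then have "int p dvd 2 * ((1 + int (z m I)) - int (card A))" by (rule dvd_mult)
    ultimately have "int p dvd ((int m + 2 + 2 * int (z m I)) - int (card A))
        - 2 * ((1 + int (z m I)) - int (card A))" by (rule dvd_diff)
    then have "int p dvd int m + int (card A)" by (simp add: algebra_simps)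
    \<comment> \<open>Since \<open>m = r * p - r\<close>, the summand \<open>m\<close> may be
      replaced by \<open>-r\<close>.\<close>
    then have "int p dvd (int m + int (card A)) - int r * int p" by (intro dvd_diff) simp_all
    moreover have "int m = int r * int p - int r"
      unfolding m_def using r by (simp add: of_nat_diff right_diff_distrib)
    ultimately show ?thesis by simp
  qed

  \<comment> \<open>Any \<open>p\<close> equal terms add up to zero, and \<open>p < m\<close> makes
    them a forbidden short null set.\<close>
  have Rsmall: "card (R i) < p" for i
  proof (rule ccontr)
    assume "\<not> card (R i) < p"
    then obtain T where T: "T \<subseteq> R i" "card T = p" "finite T"
      using obtain_subset_with_card_n[of p "R i"] by (auto simp: not_less)
    have "Z T" unfolding Z_def null_vec_def
    proof (intro allI impI)
      fix j assume j: "j < r"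
      have "(\<Sum>k\<in>T. a k j) = (\<Sum>k\<in>T. a k j - a i j) + int p * a i j"
        using T by (simp add: sum_subtractf)
      moreover have "int p dvd (\<Sum>k\<in>T. a k j - a i j)"
        using T(1) j by (intro dvd_sum) (auto simp: R_def null_vec_def)
      ultimately show "int p dvd (\<Sum>k\<in>T. a k j)" by simp
    qed
    moreover have "T \<subseteq> I" "T \<noteq> {}" using T r by (auto simp: R_def)
    ultimately show False using long[of T] T(2) m by simp
  qed
  have Z1: "Z (I - {i}) \<longleftrightarrow> null_vec p r (\<lambda>j. \<sigma> j - a i j)" if "i \<in> I" for i
    unfolding Z_def using compl[of "{i}"] that by simp
  have Z2: "Z (I - {i} - {k}) \<longleftrightarrow> null_vec p r (\<lambda>j. \<sigma> j - (a i j + a k j))"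
    if "i \<in> I" "k \<in> I" "k \<noteq> i" for i k
    unfolding Z_def using compl[of "{i, k}"] that by (simp add: Diff_insert2[symmetric] insert_commute)
  have nz: "\<not> null_vec p r (a i)" if "i \<in> I" for i
    using long[of "{i}"] that m unfolding Z_def by auto

  have A1: "null_vec p r (\<lambda>j. \<sigma> j - a i j)" if "i \<in> A" for i
    using that Z1[of i] unfolding A_def by blast

  \<comment> \<open>By \<open>relA\<close>, \<open>card A\<close> is \<open>r\<close> modulo
    \<open>p\<close>. As \<open>0 < r < p\<close>, \<open>A\<close> is nonempty; it lies in a single
    class \<open>R i\<close>, so \<open>card A < p\<close> and the congruence becomes an
    equality.\<close>
  have cardA: "card A = r"
  proof -
    have "A \<noteq> {}"
    proof
      assume "A = {}"
      then have "p dvd r" using relA by simp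
      then show False using r by (auto dest: dvd_imp_le)
    qed
    then obtain i where i: "i \<in> A" by blast
    have "A \<subseteq> R i"
    proof
      fix k assume k: "k \<in> A"
      from null_vec_diff[OF A1[OF i] A1[OF k]] show "k \<in> R i" using k by (simp add: R_def A_def)
    qed
    then have "card A \<le> card (R i)" using fin[of "R i"] by (intro card_mono) (auto simp: R_def)
    then have "card A < p" using Rsmall[of i] by linarith
    moreover have "[int (card A) = int r] (mod int p)" using relA by (simp add: cong_iff_dvd_diff)
    ultimately show ?thesis
      using r(2) by (metis cong_int_iff cong_less_modulus_unique_nat)
  qed

  \<comment> \<open>All partners of \<open>i\<close> share one term, so \<open>K i\<close> has fewer
    than \<open>p\<close> elements; being \<open>-1\<close> modulo \<open>p\<close>, their number is
    \<open>p - 1\<close>. With \<open>i\<close> in \<open>R k\<close> that class would reach size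
    \<open>p\<close>, and with \<open>k\<close> in \<open>A\<close> the term of \<open>i\<close>
    would be null.\<close>
  have K: "k \<in> I - A \<and> card (K i) = p - 1 \<and> K i \<subseteq> R k \<and> i \<notin> R k"
    if i: "i \<in> I - A" and k: "k \<in> K i" for i k
  proof -
    have kI: "k \<in> I" "k \<noteq> i" using k by (auto simp: K_def)
    have nk: "null_vec p r (\<lambda>j. \<sigma> j - (a i j + a k j))" using Z2[of i k] k i kI by (simp add: K_def)
    have sub: "K i \<subseteq> R k"
    proof
      fix l assume l: "l \<in> K i"
      then have "null_vec p r (\<lambda>j. \<sigma> j - (a i j + a l j))" using Z2[of i l] i by (simp add: K_def)
      from null_vec_diff[OF nk this] show "l \<in> R k" using l by (simp add: R_def K_def)
    qed
    have finR: "finite (R k)" using fin[of "R k"] by (auto simp: R_def)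
    have "int p dvd 1 + int (card (K i))" using relK[of i] i by (simp add: cong_0_iff)
    then have "p dvd Suc (card (K i))" using int_dvd_int_iff[of p "Suc (card (K i))"] by simp
    then have ge: "p \<le> Suc (card (K i))" by (rule dvd_imp_le) simp
    moreover have "card (K i) < p" using card_mono[OF finR sub] Rsmall[of k] by linarith
    ultimately have card: "card (K i) = p - 1" by linarith
    have notR: "i \<notin> R k"
    proof
      assume "i \<in> R k"
      then have "insert i (K i) \<subseteq> R k" using sub by simp
      then have "card (insert i (K i)) \<le> card (R k)" by (rule card_mono[OF finR])
      moreover have "card (insert i (K i)) = Suc (card (K i))"
        using finite_subset[OF sub finR] by (subst card_insert_disjoint) (auto simp: K_def)
      ultimately show False using Rsmall[of k] ge by linarith
    qed
    have "k \<notin> A"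
    proof
      assume "k \<in> A"
      then have "null_vec p r (\<lambda>j. \<sigma> j - a k j)" by (rule A1)
      from null_vec_diff[OF this nk] have "null_vec p r (a i)" by simp
      then show False using nz i by blast
    qed
    then show ?thesis using kI card sub notR by blast
  qed
  \<comment> \<open>For a partner \<open>k\<close> of \<open>i\<close>, the class \<open>R i\<close>
    equals \<open>K k\<close>. The fact \<open>K\<close> with the roles of \<open>i\<close> and
    \<open>k\<close> exchanged then gives the size.\<close>
  have cardR: "card (R i) = p - 1" if i: "i \<in> I - A" for i
  proof -
    have "K i \<noteq> {}"
      using relK[of i] i r by (auto simp: cong_0_iff)
    then obtain k where k: "k \<in> K i" by blast
    note Kk = K[OF i k]
    have "i \<in> K k" using k i by (auto simp: K_def Diff_insert2[symmetric] insert_commute)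
    have nk: "null_vec p r (\<lambda>j. \<sigma> j - (a k j + a i j))"
      using Z2[of k i] Kk i \<open>i \<in> K k\<close> by (simp add: K_def)
    have "R i \<subseteq> K k"
    proof
      fix l assume l: "l \<in> R i"
      \<comment> \<open>\<open>K k\<close> leaves out \<open>k\<close> itself, so this case has to
        be excluded through \<open>i \<notin> R k\<close>.\<close>
      have "l \<noteq> k"
      proof
        assume "l = k"
        then have "i \<in> R k" using l i by (simp add: R_def null_vec_def dvd_diff_commute)
        then show False using Kk by blast
      qed
      moreover have "null_vec p r (\<lambda>j. a l j - a i j)" using l by (simp add: R_def)
      from null_vec_diff[OF nk this] have "null_vec p r (\<lambda>j. \<sigma> j - (a k j + a l j))"
        by (simp add: algebra_simps)
      ultimately show "l \<in> K k" using Z2[of k l] l Kk by (simp add: K_def R_def)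
    qed
    moreover have "K k \<subseteq> R i" using K[of k i] Kk \<open>i \<in> K k\<close> by blast
    ultimately have "R i = K k" by blast
    then show ?thesis using K[of k i] Kk \<open>i \<in> K k\<close> by simp
  qed

  have Rrefl: "i \<in> R i" if "i \<in> I" for i using that by (simp add: R_def null_vec_def)
  have Req: "R k = R i" if "k \<in> R i" for i k
  proof -
    have ki: "null_vec p r (\<lambda>j. a k j - a i j)" "null_vec p r (\<lambda>j. a i j - a k j)"
      using that by (auto simp: R_def null_vec_def dvd_diff_commute)
    have "null_vec p r (\<lambda>j. a l j - a k j) \<longleftrightarrow> null_vec p r (\<lambda>j. a l j - a i j)" for l
      using null_vec_diff[OF _ ki(1), of "\<lambda>j. a l j - a i j"]
        null_vec_diff[OF _ ki(2), of "\<lambda>j. a l j - a k j"] by auto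
    then show ?thesis by (simp add: R_def)
  qed
  have RsubA: "R i \<subseteq> I - A" if i: "i \<in> I - A" for i
  proof
    fix k assume k: "k \<in> R i"
    have "k \<notin> A"
    proof
      assume "k \<in> A"
      then have "null_vec p r (\<lambda>j. \<sigma> j - a k j)" by (rule A1)
      moreover have "null_vec p r (\<lambda>j. a i j - a k j)"
        using k by (auto simp: R_def null_vec_def dvd_diff_commute)
      ultimately have "null_vec p r (\<lambda>j. \<sigma> j - a i j)"
        using null_vec_diff[of p r "\<lambda>j. \<sigma> j - a k j" "\<lambda>j. a i j - a k j"] by simp
      then show False using Z1 i by (auto simp: A_def)
    qed
    then show "k \<in> I - A" using k by (simp add: R_def)
  qed
  \<comment> \<open>The classes \<open>R i\<close> are equivalence classes that respect
    \<open>A\<close>, so they partition \<open>I - A\<close> into blocks of size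
    \<open>p - 1\<close>.\<close>
  have "\<Union> (R ` (I - A)) = I - A" using Rrefl RsubA by blast
  moreover have "p - 1 dvd card (\<Union> (R ` (I - A)))"
  proof (rule dvd_partition)
    show "finite (\<Union> (R ` (I - A)))" using I(1) calculation by simp
    show "\<forall>c\<in>R ` (I - A). p - 1 dvd card c" using cardR by simp
    show "\<forall>c1\<in>R ` (I - A). \<forall>c2\<in>R ` (I - A). c1 \<noteq> c2 \<longrightarrow> c1 \<inter> c2 = {}" using Req by blast
  qed
  moreover have "card (I - A) = m + 2 - r"
    using cardA cardI I(1) by (subst card_Diff_subset) (auto simp: A_def intro: fin)
  ultimately have dvd: "p - 1 dvd m + 2 - r" by simp
  \<comment> \<open>\<open>p - 1\<close> also divides \<open>m\<close>. The natural-number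
    subtractions are exact because \<open>2 \<le> r \<le> m\<close>, and they leave
    \<open>r - 2\<close>, strictly between \<open>0\<close> and \<open>p - 1\<close>.\<close>
  have "p - 1 dvd m - (m + 2 - r)" by (rule dvd_diff_nat[OF _ dvd]) (simp add: m_def)
  then have "p - 1 dvd r - 2" using m r by simp
  then have "p - 1 \<le> r - 2" by (rule dvd_imp_le) (use r in simp)
  then show False using r by linarith
qed

section \<open>Sums in the group in integer coordinates\<close>

lemma comm_group_cyclic_power: "comm_group (cyclic_power m r)"
  unfolding cyclic_power_def
  by (rule group.group_comm_groupI) (auto simp: add.commute intro!: restrict_ext)

lemma carrier_cyclic_power:
  "carrier (cyclic_power m r) = {..<r} \<rightarrow>\<^sub>E carrier (integer_mod_group m)"
  by (simp add: cyclic_power_def)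

lemma one_cyclic_power: "\<one>\<^bsub>cyclic_power m r\<^esub> = (\<lambda>i\<in>{..<r}. 0)"
  by (simp add: cyclic_power_def)

lemma pow_cyclic_power:
  assumes "j < r"
  shows "(g [^]\<^bsub>cyclic_power m r\<^esub> (n::nat)) j = int n * g j mod int m"
proof (induction n)
  case (Suc n)
  then show ?case
    using assms by (simp add: nat_pow_def cyclic_power_def mod_simps algebra_simps)
qed (use assms in \<open>simp add: nat_pow_def cyclic_power_def\<close>)

lemma finprod_cyclic_power:
  assumes "finite A" "f \<in> A \<rightarrow> carrier (cyclic_power m r)" "j < r"
  shows "finprod (cyclic_power m r) f A j = (\<Sum>x\<in>A. f x j) mod int m"
proof -
  interpret comm_group "cyclic_power m r" by (rule comm_group_cyclic_power)
  show ?thesis using assms(1,2)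
  proof (induction rule: finite_induct)
    case empty
    then show ?case using assms(3) by (simp add: one_cyclic_power)
  next
    case (insert x A)
    have "finprod (cyclic_power m r) f (insert x A)
        = f x \<otimes>\<^bsub>cyclic_power m r\<^esub> finprod (cyclic_power m r) f A"
      using insert by (intro finprod_insert) auto
    then show ?case
      using insert assms(3) by (simp add: cyclic_power_def mod_add_right_eq)
  qed
qed

lemma sum_mset_image_eq_sum_count:
  fixes f :: "'a \<Rightarrow> int"
  assumes "finite A" "set_mset S \<subseteq> A"
  shows "(\<Sum>x\<in>#S. f x) = (\<Sum>x\<in>A. int (count S x) * f x)"
  using assms(2)
proof (induction S)
  case (add y S)
  have "(\<Sum>x\<in>A. int (count (add_mset y S) x) * f x)
      = (\<Sum>x\<in>A. (if x = y then f x else 0) + int (count S x) * f x)"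
    by (rule sum.cong) (auto simp: algebra_simps)
  also have "\<dots> = f y + (\<Sum>x\<in>A. int (count S x) * f x)"
    using add.prems assms(1) by (simp add: sum.distrib)
  finally show ?case using add by simp
qed simp

text \<open>Group sums are integer sums reduced in each coordinate, and both sides of the equation
  are extensional, so comparing coordinates below \<open>r\<close> suffices.\<close>

lemma zero_sum_cyclic_power_iff:
  assumes "sequence_over (cyclic_power m r) S"
  shows "zero_sum (cyclic_power m r) S \<longleftrightarrow> null_vec m r (\<lambda>j. \<Sum>x\<in>#S. x j)"
proof -
  let ?G = "cyclic_power m r"
  interpret comm_group ?G by (rule comm_group_cyclic_power)
  have pow: "(\<lambda>g. g [^]\<^bsub>?G\<^esub> count S g) \<in> set_mset S \<rightarrow> carrier ?G"
    using assms by (auto simp: sequence_over_def)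
  have comp: "seq_sum ?G S j = (\<Sum>x\<in>#S. x j) mod int m" if "j < r" for j
    unfolding seq_sum_def
    using finprod_cyclic_power[OF finite_set_mset pow that] that
    by (simp add: pow_cyclic_power mod_sum_eq sum_mset_image_eq_sum_count[OF finite_set_mset subset_refl])
  have "seq_sum ?G S \<in> carrier ?G" unfolding seq_sum_def by (rule finprod_closed[OF pow])
  then have "seq_sum ?G S \<in> extensional {..<r}" by (simp only: carrier_cyclic_power PiE_iff)
  moreover have "\<one>\<^bsub>?G\<^esub> \<in> extensional {..<r}" by (simp add: one_cyclic_power)
  ultimately have "zero_sum ?G S \<longleftrightarrow> (\<forall>j<r. seq_sum ?G S j = \<one>\<^bsub>?G\<^esub> j)"
    unfolding zero_sum_def using extensionalityI[of "seq_sum ?G S" "{..<r}"] by auto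
  then show ?thesis
    by (simp add: comp null_vec_def one_cyclic_power dvd_eq_mod_eq_0)
qed

section \<open>From index sets to subsequences\<close>

text \<open>Positions in a list separate repeated terms, so a set of positions can describe a
  sub-multiset.\<close>

lemma subsequence_of_index_set:
  assumes "sequence_over (cyclic_power m r) (mset xs)" "T \<subseteq> {..<length xs}"
    and "null_vec m r (\<lambda>j. \<Sum>i\<in>T. (xs ! i) j)"
  obtains U where "U \<subseteq># mset xs" "size U = card T" "zero_sum (cyclic_power m r) U"
proof
  let ?U = "image_mset ((!) xs) (mset_set T)"
  have "image_mset ((!) xs) (mset_set {..<length xs}) = mset xs"
    by (metis map_nth mset_map mset_set_upto_eq_mset_upto)
  moreover have "mset_set T \<subseteq># mset_set {..<length xs}"
    using assms(2) by (intro subset_imp_msubset_mset_set) auto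
  ultimately show sub: "?U \<subseteq># mset xs" by (metis image_mset_subseteq_mono)
  show "size ?U = card T" by simp
  have "sequence_over (cyclic_power m r) ?U"
    using assms(1) set_mset_mono[OF sub] unfolding sequence_over_def by blast
  moreover have "(\<Sum>x\<in>#?U. x j) = (\<Sum>i\<in>T. (xs ! i) j)" for j
    by (simp add: sum_unfold_sum_mset image_mset.compositionality comp_def)
  ultimately show "zero_sum (cyclic_power m r) ?U"
    using assms(3) by (simp add: zero_sum_cyclic_power_iff)
qed

lemma davenport_cyclic_power_upper:
  assumes "prime p" "sequence_over (cyclic_power p r) S" "r * (p - 1) < size S"
  shows "\<exists>T. T \<subseteq># S \<and> T \<noteq> {#} \<and> zero_sum (cyclic_power p r) T"
proof -
  obtain xs where xs: "mset xs = S" using ex_mset by blast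
  have "r * (p - 1) < card {..<length xs}" using assms(3) xs by auto
  from exists_null_subset[OF assms(1) finite_lessThan this, of "\<lambda>i. xs ! i"]
  obtain T where T: "T \<subseteq> {..<length xs}" "T \<noteq> {}" "null_vec p r (\<lambda>j. \<Sum>i\<in>T. (xs ! i) j)"
    by blast
  obtain U where U: "U \<subseteq># S" "size U = card T" "zero_sum (cyclic_power p r) U"
    using subsequence_of_index_set[OF _ T(1,3)] assms(2) xs by metis
  have "card T \<noteq> 0" using T finite_subset by fastforce
  then show ?thesis using U by auto
qed

lemma short_zero_sum_upper:
  assumes "prime p" "3 \<le> r" "r < p"
    and "sequence_over (cyclic_power p r) S" "size S = r * (p - 1) + 2"
  shows "\<exists>T. T \<subseteq># S \<and> 1 \<le> size T \<and> size T < r * (p - 1) \<and> zero_sum (cyclic_power p r) T"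
proof -
  obtain xs where xs: "mset xs = S" using ex_mset by blast
  have "card {..<length xs} = r * (p - 1) + 2" using assms(5) xs by auto
  from short_null_subset[OF assms(1-3) finite_lessThan this, of "\<lambda>i. xs ! i"]
  obtain T where T: "T \<subseteq> {..<length xs}" "T \<noteq> {}" "card T < r * (p - 1)"
    "null_vec p r (\<lambda>j. \<Sum>i\<in>T. (xs ! i) j)" by blast
  obtain U where U: "U \<subseteq># S" "size U = card T" "zero_sum (cyclic_power p r) U"
    using subsequence_of_index_set[OF _ T(1,4)] assms(4) xs by metis
  have "card T \<noteq> 0" using T finite_subset by fastforce
  then show ?thesis using U T(3) by (intro exI[of _ U]) auto
qed

section \<open>The extremal sequence\<close>

text \<open>One witness for both lower bounds: everything cut from it that is nonempty and shorter
  fails to be zero-sum.\<close>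

lemma long_minimal_zero_sum_sequence:
  assumes "1 < p" "2 \<le> r"
  obtains S where "sequence_over (cyclic_power p r) S" "size S = r * (p - 1) + 1"
    "\<And>T. T \<subseteq># S \<Longrightarrow> T \<noteq> {#} \<Longrightarrow> zero_sum (cyclic_power p r) T \<Longrightarrow> size T = r * (p - 1) + 1"
proof
  \<comment> \<open>Restriction to \<open>{..<r}\<close> makes the vectors extensional, as the
    carrier demands.\<close>
  define e where "e k = (\<lambda>i\<in>{..<r}. of_bool (i = k) :: int)" for k
  define u where "u = (\<lambda>i\<in>{..<r}. 1 :: int)"
  define S where "S = add_mset u (\<Sum>k<r. replicate_mset (p - 1) (e k))"
  have e: "e k j = of_bool (j = k)" and u: "u j = 1" if "j < r" for j k
    using that by (simp_all add: e_def u_def)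
  have inj: "inj_on e {..<r}"
  proof (rule inj_onI)
    fix k l assume "k \<in> {..<r}" "l \<in> {..<r}" "e k = e l"
    then have "e k k = e l k" "k < r" by simp_all
    then show "k = l" by (simp add: e)
  qed
  \<comment> \<open>Here \<open>2 \<le> r\<close> enters: a unit vector cannot be \<open>1\<close>
    at both coordinates \<open>0\<close> and \<open>1\<close>.\<close>
  have unit: "u \<noteq> e k" for k
  proof
    assume "u = e k"
    then have "u j = of_bool (j = k)" if "j < r" for j using e[OF that] by simp
    from this[of 0] this[of 1] show False using assms(2) u[of 0] u[of 1] by (auto split: if_splits)
  qed
  have set: "set_mset S \<subseteq> insert u (e ` {..<r})"
    by (auto simp: S_def set_mset_sum split: if_splits)
  have "insert u (e ` {..<r}) \<subseteq> carrier (cyclic_power p r)"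
  proof -
    have "1 < int p" using assms(1) by linarith
    then show ?thesis
      unfolding carrier_cyclic_power carrier_integer_mod_group e_def u_def
      by (simp add: of_bool_def PiE_iff image_subset_iff)
  qed
  with set show seq: "sequence_over (cyclic_power p r) S" unfolding sequence_over_def by blast
  show "size S = r * (p - 1) + 1" by (simp add: S_def)
  have sum: "(\<Sum>x\<in>#T. f x) = int (count T u) * f u + (\<Sum>k<r. int (count T (e k)) * f (e k))"
    if "T \<subseteq># S" for T and f :: "(nat \<Rightarrow> int) \<Rightarrow> int"
  proof -
    have "set_mset T \<subseteq> insert u (e ` {..<r})" using set set_mset_mono[OF that] by blast
    then have "(\<Sum>x\<in>#T. f x) = (\<Sum>x\<in>insert u (e ` {..<r}). int (count T x) * f x)"
      by (intro sum_mset_image_eq_sum_count) simp_all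
    also have "\<dots> = int (count T u) * f u + (\<Sum>x\<in>e ` {..<r}. int (count T x) * f x)"
      using unit by (subst sum.insert) auto
    also have "(\<Sum>x\<in>e ` {..<r}. int (count T x) * f x) = (\<Sum>k<r. int (count T (e k)) * f (e k))"
      by (simp add: sum.reindex[OF inj])
    finally show ?thesis .
  qed
  have countu: "count S u = 1"
    using unit by (simp add: S_def count_sum)
  have counte: "count S (e k) = p - 1" if "k < r" for k
  proof -
    have "count S (e k) = (\<Sum>l<r. if l = k then p - 1 else 0)"
      using unit[of k] that inj unfolding S_def count_sum
      by (auto simp: count_sum inj_on_eq_iff intro!: sum.cong)
    then show ?thesis using that by simp
  qed
  fix T assume T: "T \<subseteq># S" "T \<noteq> {#}" "zero_sum (cyclic_power p r) T"
  have "sequence_over (cyclic_power p r) T"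
    using seq set_mset_mono[OF T(1)] unfolding sequence_over_def by blast
  then have null: "null_vec p r (\<lambda>j. \<Sum>x\<in>#T. x j)"
    using T(3) by (simp add: zero_sum_cyclic_power_iff)
  \<comment> \<open>In coordinate \<open>j\<close> only \<open>u\<close> and \<open>e j\<close>
    contribute.\<close>
  have dvd: "p dvd count T u + count T (e j)" if "j < r" for j
  proof -
    have "(\<Sum>x\<in>#T. x j) = int (count T u) + (\<Sum>k<r. if k = j then int (count T (e k)) else 0)"
      unfolding sum[OF T(1)] using that by (auto simp: e u intro!: sum.cong)
    then have "(\<Sum>x\<in>#T. x j) = int (count T u + count T (e j))" using that by simp
    then show ?thesis using null that by (metis null_vec_def int_dvd_int_iff)
  qed
  have le: "count T u \<le> 1" "\<And>k. k < r \<Longrightarrow> count T (e k) \<le> p - 1"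
    using mset_subset_eq_count[OF T(1)] countu counte by metis+
  have "int (size T) = (\<Sum>x\<in>#T. 1)" by simp
  also have "\<dots> = int (count T u) + (\<Sum>k<r. int (count T (e k)))" unfolding sum[OF T(1)] by simp
  finally have size: "size T = count T u + (\<Sum>k<r. count T (e k))" by (simp only: of_nat_eq_iff flip: of_nat_sum of_nat_add)
  \<comment> \<open>Without \<open>u\<close> every multiplicity is a multiple of \<open>p\<close>
    that is at most \<open>p - 1\<close>, so \<open>T\<close> would be empty.\<close>
  have "count T u \<noteq> 0"
  proof
    assume 0: "count T u = 0"
    have "count T (e k) = 0" if "k < r" for k
      using dvd[OF that] le(2)[OF that] 0 assms(1) by (auto dest: dvd_imp_le)
    then have "size T = 0" using size 0 by simp
    then show False using T(2) by simp
  qed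
  then have 1: "count T u = 1" using le(1) by linarith
  \<comment> \<open>Now \<open>p\<close> divides \<open>1 + count T (e k)\<close>, which forces the
    largest possible multiplicity.\<close>
  have "count T (e k) = p - 1" if "k < r" for k
    using dvd_imp_le[OF dvd[OF that]] le(2)[OF that] 1 by simp
  then show "size T = r * (p - 1) + 1" using size 1 by simp
qed

lemma subsequence_of_size:
  assumes "l \<le> size S"
  obtains T where "T \<subseteq># S" "size T = l"
proof -
  obtain xs where xs: "mset xs = S" using ex_mset by blast
  have "mset (take l xs) \<subseteq># mset (take l xs @ drop l xs)"
    unfolding mset_append by simp
  moreover have "size (mset (take l xs)) = l" using assms xs by auto
  ultimately show ?thesis using that xs by simp
qed

section \<open>Values of the two constants\<close>

text \<open>For a smaller \<open>l\<close>, any \<open>l\<close> terms of the extremal sequence form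
  a counterexample: a nonempty zero-sum subsequence would need the full length.\<close>

lemma davenport_cyclic_power:
  assumes "prime p" "2 \<le> r"
  shows "davenport (cyclic_power p r) = r * (p - 1) + 1"
  unfolding davenport_def
proof (rule Least_equality)
  show "\<forall>S. sequence_over (cyclic_power p r) S \<and> size S = r * (p - 1) + 1 \<longrightarrow>
      (\<exists>T. T \<subseteq># S \<and> T \<noteq> {#} \<and> zero_sum (cyclic_power p r) T)"
    using davenport_cyclic_power_upper[OF assms(1)] by simp
next
  fix l assume l: "\<forall>S. sequence_over (cyclic_power p r) S \<and> size S = l \<longrightarrow>
      (\<exists>T. T \<subseteq># S \<and> T \<noteq> {#} \<and> zero_sum (cyclic_power p r) T)"
  obtain S where S: "sequence_over (cyclic_power p r) S" "size S = r * (p - 1) + 1"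
    "\<And>T. T \<subseteq># S \<Longrightarrow> T \<noteq> {#} \<Longrightarrow> zero_sum (cyclic_power p r) T \<Longrightarrow> size T = r * (p - 1) + 1"
    using long_minimal_zero_sum_sequence[of p r] assms prime_gt_1_nat by blast
  show "r * (p - 1) + 1 \<le> l"
  proof (rule ccontr)
    assume less: "\<not> ?thesis"
    then have "l \<le> size S" using S(2) by linarith
    then obtain S' where S': "S' \<subseteq># S" "size S' = l" using subsequence_of_size by blast
    have "sequence_over (cyclic_power p r) S'"
      using S(1) set_mset_mono[OF S'(1)] unfolding sequence_over_def by blast
    then obtain T where T: "T \<subseteq># S'" "T \<noteq> {#}" "zero_sum (cyclic_power p r) T"
      using l S'(2) by blast
    have "size T = r * (p - 1) + 1" using S(3) T S'(1) subset_mset.order_trans by blast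
    moreover have "size T \<le> l" using size_mset_mono[OF T(1)] S'(2) by simp
    ultimately show False using less by simp
  qed
qed

theorem theorem1p4:
  fixes p r :: nat
  assumes "prime p" and "3 \<le> r" and "r < p"
  shows "s_le (davenport (cyclic_power p r) - 2) (cyclic_power p r)
         = davenport (cyclic_power p r) + 1"
proof -
  have D: "davenport (cyclic_power p r) = r * (p - 1) + 1"
    using assms by (intro davenport_cyclic_power) simp_all
  have "s_le (r * (p - 1) + 1 - 2) (cyclic_power p r) = r * (p - 1) + 2"
    unfolding s_le_def
  proof (rule Least_equality)
    \<comment> \<open>The strict bound becomes \<open>D - 2\<close> because
      \<open>D = r * (p - 1) + 1\<close>.\<close>
    have "size T \<le> r * (p - 1) + 1 - 2" if "size T < r * (p - 1)" for T :: "(nat \<Rightarrow> int) multiset"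
      using that by simp
    then show "\<forall>S. sequence_over (cyclic_power p r) S \<and> size S = r * (p - 1) + 2 \<longrightarrow>
        (\<exists>T. T \<subseteq># S \<and> 1 \<le> size T \<and> size T \<le> r * (p - 1) + 1 - 2 \<and> zero_sum (cyclic_power p r) T)"
      using short_zero_sum_upper[OF assms] by blast
  next
    fix l assume l: "\<forall>S. sequence_over (cyclic_power p r) S \<and> size S = l \<longrightarrow>
        (\<exists>T. T \<subseteq># S \<and> 1 \<le> size T \<and> size T \<le> r * (p - 1) + 1 - 2 \<and> zero_sum (cyclic_power p r) T)"
    \<comment> \<open>Every nonempty zero-sum subsequence of this \<open>S\<close> has length
      \<open>D\<close>, beyond the allowed \<open>D - 2\<close>; hence no \<open>l \<le> D\<close>
      has the property.\<close>
    obtain S where S: "sequence_over (cyclic_power p r) S" "size S = r * (p - 1) + 1"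
      "\<And>T. T \<subseteq># S \<Longrightarrow> T \<noteq> {#} \<Longrightarrow> zero_sum (cyclic_power p r) T \<Longrightarrow> size T = r * (p - 1) + 1"
      using long_minimal_zero_sum_sequence[of p r] assms prime_gt_1_nat by auto
    show "r * (p - 1) + 2 \<le> l"
    proof (rule ccontr)
      assume less: "\<not> ?thesis"
      then have "l \<le> size S" using S(2) by linarith
      then obtain S' where S': "S' \<subseteq># S" "size S' = l" using subsequence_of_size by blast
      have "sequence_over (cyclic_power p r) S'"
        using S(1) set_mset_mono[OF S'(1)] unfolding sequence_over_def by blast
      then obtain T where T: "T \<subseteq># S'" "1 \<le> size T" "size T \<le> r * (p - 1) + 1 - 2"
        "zero_sum (cyclic_power p r) T" using l S'(2) by blast
      have "T \<subseteq># S" using T(1) S'(1) subset_mset.order_trans by blast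
      moreover have "T \<noteq> {#}" using T(2) by auto
      ultimately have "size T = r * (p - 1) + 1" using S(3) T(4) by blast
      then show False using T(3) by linarith
    qed
  qed
  then show ?thesis by (simp add: D)
qed

end
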